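(* Let $A$ be a Banach algebra with a sequential contractive approximate identity ${\mathfrak e}=(e_n)$. If $Q_{\mathfrak e}(A)$ is weak* closed in $A^*$, then $A$ possesses a sequential contractive approximate identity contained in ${\mathfrak r}^{\mathfrak e}_A$. Moreover, for every $a\in A$ with $\inf\{\mathrm{Re}\,\varphi(a):\varphi\in S_{\mathfrak e}(A)\}>-1$, there is a sequential contractive approximate identity $(f_n)$ in ${\mathfrak r}^{\mathfrak e}_A$ such that $f_n+a\in{\mathfrak r}^{\mathfrak e}_A$ for all $n$.
   Context: Banach algebras are complex with submultiplicative norm. A contractive approximate identity (cai) is a net (here a sequence) $(e_n)$ with $\|e_n\|\le1$ and $e_na\to a$, $ae_n\to a$ for all $a\in A$. For the fixed cai ${\mathfrak e}=(e_n)$: $S_{\mathfrak e}(A)=\{\varphi\in A^*:\|\varphi\|\le 1,\ \lim_n\varphi(e_n)=1\}$; $Q_{\mathfrak e}(A)=\{t\varphi: t\in[0,1],\ \varphi\in S_{\mathfrak e}(A)\}$; ${\mathfrak r}^{\mathfrak e}_A=\{x\in A:\mathrm{Re}\,\varphi(x)\ge 0$ for all $\varphi\in S_{\mathfrak e}(A)\}$. *)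

theory Defs
  imports "HOL-Analysis.Analysis"
begin

text \<open>A complex Banach algebra is encoded as a real Banach algebra
  (type class real_normed_algebra + banach: associative, submultiplicative norm,
  complete; not necessarily unital) together with an operator J ("multiplication
  by the imaginary unit") making it a complex normed algebra: complex scalar
  multiplication is (a + b i) x = a x + b (J x).\<close>

definition complex_structure :: "('a::{real_normed_algebra,banach} \<Rightarrow> 'a) \<Rightarrow> bool" where
  "complex_structure J \<longleftrightarrow>
     linear J \<and>
     (\<forall>x. J (J x) = - x) \<and>
     (\<forall>t x. norm (cos t *\<^sub>R x + sin t *\<^sub>R J x) = norm x) \<and>
     (\<forall>x y. J (x * y) = J x * y) \<and>
     (\<forall>x y. J (x * y) = x * J y)"

definition cdual :: "('a::{real_normed_algebra,banach} \<Rightarrow> 'a) \<Rightarrow> ('a \<Rightarrow> complex) set" where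
  "cdual J = {\<phi>. bounded_linear \<phi> \<and> (\<forall>x. \<phi> (J x) = \<i> * \<phi> x)}"

definition seq_cai :: "(nat \<Rightarrow> 'a::{real_normed_algebra,banach}) \<Rightarrow> bool" where
  "seq_cai e \<longleftrightarrow> (\<forall>n. norm (e n) \<le> 1) \<and>
     (\<forall>a. (\<lambda>n. e n * a) \<longlonglongrightarrow> a) \<and> (\<forall>a. (\<lambda>n. a * e n) \<longlonglongrightarrow> a)"

definition S_e :: "('a::{real_normed_algebra,banach} \<Rightarrow> 'a) \<Rightarrow> (nat \<Rightarrow> 'a) \<Rightarrow> ('a \<Rightarrow> complex) set" where
  "S_e J e = {\<phi> \<in> cdual J. (\<forall>x. cmod (\<phi> x) \<le> norm x) \<and> (\<lambda>n. \<phi> (e n)) \<longlonglongrightarrow> 1}"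

definition Q_e :: "('a::{real_normed_algebra,banach} \<Rightarrow> 'a) \<Rightarrow> (nat \<Rightarrow> 'a) \<Rightarrow> ('a \<Rightarrow> complex) set" where
  "Q_e J e = {(\<lambda>x. complex_of_real t * \<phi> x) | t \<phi>. t \<in> {0..1} \<and> \<phi> \<in> S_e J e}"

definition r_e :: "('a::{real_normed_algebra,banach} \<Rightarrow> 'a) \<Rightarrow> (nat \<Rightarrow> 'a) \<Rightarrow> 'a set" where
  "r_e J e = {x. \<forall>\<phi> \<in> S_e J e. Re (\<phi> x) \<ge> 0}"

text \<open>Weak* topology on A^*: the topology of pointwise convergence, i.e. the
  subspace topology induced by the product topology on 'a \<Rightarrow> complex.\<close>
definition weak_star_closed :: "('a::{real_normed_algebra,banach} \<Rightarrow> 'a) \<Rightarrow> ('a \<Rightarrow> complex) set \<Rightarrow> bool" where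
  "weak_star_closed J Q \<longleftrightarrow> Q \<subseteq> cdual J \<and> closedin (top_of_set (cdual J)) Q"

end

theory Submission
  imports Defs
begin

text \<open>
  The set \<open>Q\<close> is convex and weak* compact, and every \<open>\<phi> = t \<psi>\<close> in it satisfies
  \<open>\<phi> (e n) \<longlonglongrightarrow> t\<close>. If \<open>Re \<psi> x \<ge> - \<delta>\<close> on \<open>S\<close>, then \<open>lim Re \<phi> (\<delta> e\<^sub>n + x) \<ge> 0\<close> for all
  \<open>\<phi> \<in> Q\<close>; Fan's minimax theorem turns this pointwise statement into a uniform one: for
  every \<open>\<epsilon> > 0\<close> some convex combination \<open>g\<close> of the \<open>e\<^sub>n\<close> has \<open>Re \<phi> (\<delta> g + x) \<ge> - \<epsilon>\<close> on \<open>Q\<close>.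
  Starting with \<open>x = a\<close> and \<open>\<delta> < 1\<close>, and repeatedly adding such corrections with weights
  \<open>\<delta>\<^sub>k\<close> of total sum 1, one gets \<open>f\<close> in the closed convex hull of a tail of \<open>(e\<^sub>n)\<close>
  with \<open>Re \<phi> (f + a) \<ge> 0\<close>. Running the same corrections for \<open>x = 0\<close> at the same time makes
  \<open>f\<close> itself real positive. The first claim is the case \<open>a = 0\<close>.
\<close>

section \<open>A minimax theorem\<close>

text \<open>Convexity of \<open>K\<close> as far as the functions \<open>F g\<close> can see it: one
  point \<open>r\<close> serves all \<open>g\<close> at once. No vector space structure on
  \<open>K\<close> is required, so the notion applies to sets of functionals combined
  pointwise.\<close>

definition convexlike_on :: "'k set \<Rightarrow> 'i set \<Rightarrow> ('i \<Rightarrow> 'k \<Rightarrow> real) \<Rightarrow> bool" where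
  "convexlike_on K G F \<longleftrightarrow>
     (\<forall>p\<in>K. \<forall>q\<in>K. \<forall>s\<in>{0..1}. \<exists>r\<in>K. \<forall>g\<in>G. F g r = s * F g p + (1 - s) * F g q)"

lemma convexlike_onD:
  assumes "convexlike_on K G F" "p \<in> K" "q \<in> K" "0 \<le> s" "s \<le> 1"
  obtains r where "r \<in> K" "\<And>g. g \<in> G \<Longrightarrow> F g r = s * F g p + (1 - s) * F g q"
  using assms unfolding convexlike_on_def by (metis atLeastAtMost_iff)

text \<open>Allows \<open>K\<close> to be cut down to a sublevel set in the induction for finitely
  many functions.\<close>

lemma convexlike_on_sublevel:
  assumes "convexlike_on K G F" "g \<in> G"
  shows "convexlike_on {k \<in> K. F g k \<le> 0} G F"
  unfolding convexlike_on_def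
proof (intro ballI)
  fix p q and s :: real
  assume p: "p \<in> {k \<in> K. F g k \<le> 0}" and q: "q \<in> {k \<in> K. F g k \<le> 0}" and s: "s \<in> {0..1}"
  then obtain r where r: "r \<in> K" "\<And>g. g \<in> G \<Longrightarrow> F g r = s * F g p + (1 - s) * F g q"
    using convexlike_onD[OF assms(1), of p q s] by auto
  have "s * F g p \<le> 0" "(1 - s) * F g q \<le> 0"
    using p q s by (auto simp: mult_nonneg_nonpos)
  then have "F g r \<le> 0"
    using r(2)[OF assms(2)] by linarith
  then show "\<exists>r\<in>{k \<in> K. F g k \<le> 0}. \<forall>g\<in>G. F g r = s * F g p + (1 - s) * F g q"
    using r by blast
qed

text \<open>The image of \<open>K\<close> under \<open>(F a, F b)\<close> is compact and convex in
  the plane. If it missed the closed negative quadrant, a separating line would have a normal with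
  nonnegative coordinates; normalised to sum 1, these give a convex combination that is positive on
  \<open>K\<close>.\<close>

lemma minimax_two_functions:
  fixes F :: "'i \<Rightarrow> 'k::topological_space \<Rightarrow> real"
  assumes K: "compact K" and cont: "\<And>g. g \<in> {a, b} \<Longrightarrow> continuous_on K (F g)"
    and cvx: "convexlike_on K {a, b} F"
    and neg: "\<And>s. 0 \<le> s \<Longrightarrow> s \<le> 1 \<Longrightarrow> \<exists>k\<in>K. s * F a k + (1 - s) * F b k \<le> 0"
  shows "\<exists>k\<in>K. F a k \<le> 0 \<and> F b k \<le> 0"
proof (rule ccontr)
  assume no: "\<not> ?thesis"
  define C where "C = (\<lambda>k. (F a k, F b k)) ` K"
  define D :: "(real \<times> real) set" where "D = {..0} \<times> {..0}"
  have "compact C"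
    unfolding C_def by (intro compact_continuous_image K continuous_intros cont) auto
  moreover have "convex C"
    unfolding convex_alt C_def
  proof clarify
    fix p q and u :: real assume "p \<in> K" "q \<in> K" "0 \<le> u" "u \<le> 1"
    then obtain r where "r \<in> K" "\<And>g. g \<in> {a, b} \<Longrightarrow> F g r = (1 - u) * F g p + (1 - (1 - u)) * F g q"
      using convexlike_onD[OF cvx, of p q "1 - u"] by auto
    then show "(1 - u) *\<^sub>R (F a p, F b p) + u *\<^sub>R (F a q, F b q) \<in> (\<lambda>k. (F a k, F b k)) ` K"
      by (intro image_eqI[of _ _ r]) auto
  qed
  moreover have "closed D" "convex D" "D \<noteq> {}"
    unfolding D_def by (auto intro: closed_Times convex_Times)
  moreover have "D \<inter> C = {}"
    using no unfolding C_def D_def by auto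
  moreover have "C \<noteq> {}"
    using neg[of 0] unfolding C_def by auto
  ultimately obtain v c where v: "\<And>x. x \<in> D \<Longrightarrow> inner v x < c" "\<And>x. x \<in> C \<Longrightarrow> inner v x > c"
    using separating_hyperplane_closed_compact[of D C] by metis
  obtain v1 v2 where v12: "v = (v1, v2)" by fastforce
  have c: "c > 0"
    using v(1)[of "(0, 0)"] unfolding D_def by (simp add: v12)
  \<comment> \<open>For \<open>v1 < 0\<close> the point \<open>(c / v1, 0)\<close> lies in the
    quadrant, and its inner product with \<open>v\<close> is exactly \<open>c\<close>, against
    strict separation.\<close>
  have pos: "v1 \<ge> 0"
  proof (rule ccontr)
    assume "\<not> v1 \<ge> 0"
    with v(1)[of "(c / v1, 0)"] c show False
      unfolding D_def by (simp add: v12 divide_nonneg_neg)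
  qed
  have pos2: "v2 \<ge> 0"
  proof (rule ccontr)
    assume "\<not> v2 \<ge> 0"
    with v(1)[of "(0, c / v2)"] c show False
      unfolding D_def by (simp add: v12 divide_nonneg_neg)
  qed
  have sep: "v1 * F a k + v2 * F b k > 0" if "k \<in> K" for k
    using v(2)[of "(F a k, F b k)"] c that unfolding C_def by (auto simp: v12)
  have sum: "v1 + v2 > 0"
  proof -
    obtain k where "k \<in> K" using neg[of 0] by auto
    from sep[OF this] pos pos2 show ?thesis
      by (cases "v1 = 0"; cases "v2 = 0") auto
  qed
  obtain k where k: "k \<in> K" "v1 / (v1 + v2) * F a k + (1 - v1 / (v1 + v2)) * F b k \<le> 0"
    using neg[of "v1 / (v1 + v2)"] pos pos2 sum by auto
  have "v1 / (v1 + v2) * F a k + (1 - v1 / (v1 + v2)) * F b k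
      = (v1 * F a k + v2 * F b k) / (v1 + v2)"
  proof -
    have "1 - v1 / (v1 + v2) = v2 / (v1 + v2)" using sum by (simp add: field_simps)
    then show ?thesis by (simp add: add_divide_distrib)
  qed
  with k sep[OF k(1)] sum show False
    by (simp add: divide_le_0_iff)
qed

text \<open>Induction on \<open>H\<close> with \<open>K\<close> varying: \<open>K\<close> shrinks to
  the sublevel set of the new function \<open>a\<close>. By the case of two functions, every
  \<open>g\<close> in \<open>G\<close> still has a point with \<open>F g k \<le> 0\<close>
  there.\<close>

lemma minimax_finite:
  fixes F :: "'i::real_vector \<Rightarrow> 'k::topological_space \<Rightarrow> real"
  assumes "finite H" "H \<subseteq> G" "convex G"
    and aff: "\<And>g h s k. g \<in> G \<Longrightarrow> h \<in> G \<Longrightarrow> 0 \<le> s \<Longrightarrow> s \<le> 1 \<Longrightarrow>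
      F (s *\<^sub>R g + (1 - s) *\<^sub>R h) k = s * F g k + (1 - s) * F h k"
    and "compact K" "\<And>g. g \<in> G \<Longrightarrow> continuous_on K (F g)" "convexlike_on K G F" "K \<noteq> {}"
    and "\<And>g. g \<in> G \<Longrightarrow> \<exists>k\<in>K. F g k \<le> 0"
  shows "\<exists>k\<in>K. \<forall>g\<in>H. F g k \<le> 0"
  using assms(1,2,5-9)
proof (induction H arbitrary: K rule: finite_induct)
  case empty
  then show ?case by auto
next
  case (insert a H)
  let ?K = "{k \<in> K. F a k \<le> 0}"
  have a: "a \<in> G" using insert.prems by auto
  have cont: "continuous_on ?K (F g)" if "g \<in> G" for g
    using insert.prems(3)[OF that] by (rule continuous_on_subset) auto
  have "closedin (top_of_set K) (K \<inter> F a -` {..0})"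
    by (intro continuous_closedin_preimage insert.prems(3) a) auto
  then have "compact (K \<inter> F a -` {..0})"
    using insert.prems(2) closedin_compact by blast
  then have comp: "compact ?K"
    by (simp add: Int_def vimage_def)
  have ex: "\<exists>k\<in>?K. F g k \<le> 0" if g: "g \<in> G" for g
  proof -
    have "\<exists>k\<in>K. F a k \<le> 0 \<and> F g k \<le> 0"
    proof (rule minimax_two_functions)
      show "convexlike_on K {a, g} F"
        using insert.prems(4) a g unfolding convexlike_on_def
        by (metis (no_types, lifting) empty_iff insert_iff)
      fix s :: real assume s: "0 \<le> s" "s \<le> 1"
      \<comment> \<open>A convex combination of \<open>F a\<close> and \<open>F g\<close> is again
        some \<open>F h\<close> with \<open>h\<close> in \<open>G\<close>, so the pointwise
        hypothesis covers it.\<close>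
      have "s *\<^sub>R a + (1 - s) *\<^sub>R g \<in> G"
        using \<open>convex G\<close> a g s by (simp add: convex_def)
      from insert.prems(6)[OF this] show "\<exists>k\<in>K. s * F a k + (1 - s) * F g k \<le> 0"
        using aff[OF a g s] by simp
    qed (use insert.prems a g in auto)
    then show ?thesis by blast
  qed
  have "\<exists>k\<in>?K. \<forall>g\<in>H. F g k \<le> 0"
  proof (rule insert.IH)
    show "convexlike_on ?K G F"
      by (rule convexlike_on_sublevel[OF insert.prems(4) a])
    show "?K \<noteq> {}" using insert.prems(6)[OF a] by blast
  qed (use insert.prems comp cont ex in auto)
  then show ?case by auto
qed

text \<open>The sublevel sets are closed in the compact \<open>K\<close> and, by the finite case,
  have the finite intersection property.\<close>

lemma minimax:
  fixes F :: "'i::real_vector \<Rightarrow> 'k::topological_space \<Rightarrow> real"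
  assumes "convex G"
    and aff: "\<And>g h s k. g \<in> G \<Longrightarrow> h \<in> G \<Longrightarrow> 0 \<le> s \<Longrightarrow> s \<le> 1 \<Longrightarrow>
      F (s *\<^sub>R g + (1 - s) *\<^sub>R h) k = s * F g k + (1 - s) * F h k"
    and K: "compact K" "K \<noteq> {}" and cont: "\<And>g. g \<in> G \<Longrightarrow> continuous_on K (F g)"
    and "convexlike_on K G F"
    and "\<And>g. g \<in> G \<Longrightarrow> \<exists>k\<in>K. F g k \<le> 0"
  shows "\<exists>k\<in>K. \<forall>g\<in>G. F g k \<le> 0"
proof -
  let ?S = "\<lambda>g. {k \<in> K. F g k \<le> 0}"
  have "\<exists>T. closed T \<and> ?S g = K \<inter> T" if "g \<in> G" for g
  proof -
    have "closedin (top_of_set K) (K \<inter> F g -` {..0})"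
      by (intro continuous_closedin_preimage cont that) auto
    then show ?thesis
      by (auto simp: closedin_closed Int_def vimage_def)
  qed
  then obtain T where T: "\<And>g. g \<in> G \<Longrightarrow> closed (T g)" "\<And>g. g \<in> G \<Longrightarrow> ?S g = K \<inter> T g"
    by metis
  have "K \<inter> (\<Inter>g\<in>G. T g) \<noteq> {}"
  proof (rule compact_imp_fip_image[OF K(1)])
    fix H assume H: "finite H" "H \<subseteq> G"
    obtain k where "k \<in> K" "\<forall>g\<in>H. F g k \<le> 0"
      using minimax_finite[of H G F K] H assms by blast
    then have "k \<in> K \<inter> (\<Inter>g\<in>H. T g)" using T(2) H by blast
    then show "K \<inter> (\<Inter>g\<in>H. T g) \<noteq> {}" by blast
  qed (use T in auto)
  then show ?thesis using T(2) by blast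
qed

section \<open>The quasi-state space\<close>

lemma Q_eE:
  assumes "\<phi> \<in> Q_e J e"
  obtains t \<psi> where "0 \<le> t" "t \<le> 1" "\<psi> \<in> S_e J e" "\<phi> = (\<lambda>x. complex_of_real t * \<psi> x)"
  using assms unfolding Q_e_def by auto

lemma S_e_subset_Q_e: "S_e J e \<subseteq> Q_e J e"
proof
  fix \<phi> assume "\<phi> \<in> S_e J e"
  then show "\<phi> \<in> Q_e J e"
    unfolding Q_e_def by (intro CollectI exI[of _ 1] exI[of _ \<phi>]) auto
qed

lemma zero_in_Q_e:
  assumes "S_e J e \<noteq> {}"
  shows "(\<lambda>x. 0) \<in> Q_e J e"
proof -
  obtain \<phi> where "\<phi> \<in> S_e J e" using assms by auto
  then show ?thesis
    unfolding Q_e_def by (intro CollectI exI[of _ 0] exI[of _ \<phi>]) auto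
qed

lemma S_e_linear:
  assumes "\<phi> \<in> S_e J e"
  shows "\<phi> (x + y) = \<phi> x + \<phi> y" "\<phi> (r *\<^sub>R x) = of_real r * \<phi> x"
proof -
  interpret bounded_linear \<phi> using assms by (auto simp: S_e_def cdual_def)
  show "\<phi> (x + y) = \<phi> x + \<phi> y" "\<phi> (r *\<^sub>R x) = of_real r * \<phi> x"
    by (auto simp: add scaleR scaleR_conv_of_real)
qed

lemma Q_e_linear:
  assumes "\<phi> \<in> Q_e J e"
  shows "\<phi> (x + y) = \<phi> x + \<phi> y" "\<phi> (r *\<^sub>R x) = of_real r * \<phi> x"
  using assms by (auto elim!: Q_eE simp: S_e_linear algebra_simps)

lemma S_e_convex:
  assumes "\<phi> \<in> S_e J e" "\<psi> \<in> S_e J e" "0 \<le> s" "s \<le> 1"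
  shows "(\<lambda>x. of_real s * \<phi> x + of_real (1 - s) * \<psi> x) \<in> S_e J e"
proof -
  have "cmod (of_real s * \<phi> x + of_real (1 - s) * \<psi> x) \<le> norm x" for x
  proof -
    have "cmod (of_real s * \<phi> x + of_real (1 - s) * \<psi> x)
        \<le> cmod (of_real s * \<phi> x) + cmod (of_real (1 - s) * \<psi> x)"
      by (rule norm_triangle_ineq)
    also have "\<dots> = s * cmod (\<phi> x) + (1 - s) * cmod (\<psi> x)"
      using assms(3,4) by (simp add: norm_mult del: of_real_diff)
    also have "\<dots> \<le> s * norm x + (1 - s) * norm x"
      using assms by (intro add_mono mult_left_mono) (auto simp: S_e_def)
    finally show ?thesis by (simp add: algebra_simps)
  qed
  moreover have "(\<lambda>n. of_real s * \<phi> (e n) + of_real (1 - s) * \<psi> (e n))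
      \<longlonglongrightarrow> of_real s * 1 + of_real (1 - s) * 1"
    using assms by (intro tendsto_intros) (auto simp: S_e_def)
  moreover have "bounded_linear (\<lambda>x. of_real s * \<phi> x + of_real (1 - s) * \<psi> x)"
    using assms by (intro bounded_linear_add bounded_linear_const_mult)
      (auto simp: S_e_def cdual_def)
  ultimately show ?thesis
    using assms by (auto simp: S_e_def cdual_def algebra_simps)
qed

text \<open>The total mass \<open>\<tau> = s * t + (1 - s) * u\<close> is factored out; what remains
  is a convex combination of two elements of \<open>S_e J e\<close>. If \<open>\<tau> = 0\<close>
  the result is the zero functional.\<close>

lemma Q_e_convex:
  assumes "\<phi> \<in> Q_e J e" "\<psi> \<in> Q_e J e" "0 \<le> s" "s \<le> 1"
  shows "(\<lambda>x. of_real s * \<phi> x + of_real (1 - s) * \<psi> x) \<in> Q_e J e"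
proof -
  obtain t \<phi>' where t: "0 \<le> t" "t \<le> 1" "\<phi>' \<in> S_e J e" "\<phi> = (\<lambda>x. of_real t * \<phi>' x)"
    using assms(1) by (rule Q_eE)
  obtain u \<psi>' where u: "0 \<le> u" "u \<le> 1" "\<psi>' \<in> S_e J e" "\<psi> = (\<lambda>x. of_real u * \<psi>' x)"
    using assms(2) by (rule Q_eE)
  define \<tau> where "\<tau> = s * t + (1 - s) * u"
  have nonneg: "0 \<le> s * t" "0 \<le> (1 - s) * u" using assms t u by auto
  have \<tau>1: "\<tau> \<le> 1"
    unfolding \<tau>_def using convex_bound_le[of t 1 u s "1 - s"] assms t u by simp
  show ?thesis
  proof (cases "\<tau> = 0")
    case True
    then have "s * t = 0" "(1 - s) * u = 0" using nonneg unfolding \<tau>_def by linarith+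
    then have "(\<lambda>x. of_real s * \<phi> x + of_real (1 - s) * \<psi> x) = (\<lambda>x. 0)"
      by (auto simp: t u)
    then show ?thesis using zero_in_Q_e t(3) by auto
  next
    case False
    then have \<tau>0: "\<tau> > 0" using nonneg unfolding \<tau>_def by linarith
    define r where "r = s * t / \<tau>"
    have r: "0 \<le> r" "r \<le> 1" "\<tau> * r = s * t" "\<tau> * (1 - r) = (1 - s) * u"
      using \<tau>0 nonneg unfolding r_def by (auto simp: field_simps \<tau>_def)
    have eq: "of_real s * \<phi> x + of_real (1 - s) * \<psi> x
        = of_real \<tau> * (of_real r * \<phi>' x + of_real (1 - r) * \<psi>' x)" for x
    proof -
      have "of_real \<tau> * (of_real r * \<phi>' x + of_real (1 - r) * \<psi>' x)
          = of_real (\<tau> * r) * \<phi>' x + of_real (\<tau> * (1 - r)) * \<psi>' x"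
        by (simp only: of_real_mult distrib_left mult.assoc)
      then show ?thesis unfolding r(3,4) by (simp add: t u)
    qed
    show ?thesis
      unfolding Q_e_def eq using S_e_convex[OF t(3) u(3) r(1,2)] \<tau>0 \<tau>1
      by (intro CollectI exI[of _ \<tau>] exI) auto
  qed
qed

lemma Q_e_bound:
  assumes "\<phi> \<in> Q_e J e"
  shows "cmod (\<phi> x) \<le> norm x"
proof -
  obtain t \<psi> where t: "0 \<le> t" "t \<le> 1" "\<psi> \<in> S_e J e" "\<phi> = (\<lambda>x. of_real t * \<psi> x)"
    using assms by (rule Q_eE)
  have "cmod (\<phi> x) = t * cmod (\<psi> x)" using t by (simp add: norm_mult)
  also have "\<dots> \<le> 1 * norm x" using t by (intro mult_mono) (auto simp: S_e_def)
  finally show ?thesis by simp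
qed

section \<open>Weak* compactness\<close>

lemma continuous_on_eval: "continuous_on UNIV (\<lambda>\<phi>::'a \<Rightarrow> complex. \<phi> x)"
  by (rule continuous_on_product_coordinates)

text \<open>Banach-Alaoglu: by Tychonoff the product of the discs of radius \<open>norm x\<close> is
  compact, and linearity and compatibility with \<open>J\<close> are closed conditions for pointwise
  convergence.\<close>

lemma compact_dual_ball:
  fixes J :: "'a::{real_normed_algebra,banach} \<Rightarrow> 'a"
  shows "compact (cdual J \<inter> {\<phi>. \<forall>x. cmod (\<phi> x) \<le> norm x})"
proof -
  let ?P = "PiE UNIV (\<lambda>x::'a. cball (0::complex) (norm x))"
  let ?L = "{\<phi>::'a \<Rightarrow> complex. (\<forall>x y. \<phi> (x + y) = \<phi> x + \<phi> y) \<and>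
      (\<forall>r x. \<phi> (r *\<^sub>R x) = r *\<^sub>R \<phi> x) \<and> (\<forall>x. \<phi> (J x) = \<i> * \<phi> x)}"
  have "compact ?P"
    using compactin_PiE[of "\<lambda>x. euclidean" UNIV "\<lambda>x::'a. cball (0::complex) (norm x)"]
    by (simp add: euclidean_product_topology)
  moreover have "closed ?L"
    by (intro closed_Collect_conj closed_Collect_all closed_Collect_eq
        continuous_intros continuous_on_eval)
  ultimately have "compact (?P \<inter> ?L)"
    by (rule compact_Int_closed)
  moreover have "cdual J \<inter> {\<phi>. \<forall>x. cmod (\<phi> x) \<le> norm x} = ?P \<inter> ?L"
  proof (intro equalityI subsetI)
    fix \<phi> assume "\<phi> \<in> cdual J \<inter> {\<phi>. \<forall>x. cmod (\<phi> x) \<le> norm x}"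
    then show "\<phi> \<in> ?P \<inter> ?L"
      by (auto simp: cdual_def bounded_linear.linear linear_add linear_scale)
  next
    fix \<phi> assume \<phi>: "\<phi> \<in> ?P \<inter> ?L"
    then have le: "\<forall>x. cmod (\<phi> x) \<le> norm x" by (auto simp: PiE_iff)
    have "bounded_linear \<phi>"
      by (rule bounded_linear_intro[of _ 1]) (use \<phi> le in auto)
    then show "\<phi> \<in> cdual J \<inter> {\<phi>. \<forall>x. cmod (\<phi> x) \<le> norm x}"
      using \<phi> le by (auto simp: cdual_def)
  qed
  ultimately show ?thesis by simp
qed

text \<open>Closedness is only relative to \<open>cdual J\<close>, but \<open>Q_e J e\<close> lies
  in the dual ball, so it is the intersection of a compact set with a closed one.\<close>

lemma compact_Q_e:
  assumes "weak_star_closed J (Q_e J e)"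
  shows "compact (Q_e J e)"
proof -
  obtain T where T: "closed T" "Q_e J e = cdual J \<inter> T"
    using assms unfolding weak_star_closed_def by (auto simp: closedin_closed)
  then have "Q_e J e = cdual J \<inter> {\<phi>. \<forall>x. cmod (\<phi> x) \<le> norm x} \<inter> T"
    using Q_e_bound by blast
  then show ?thesis
    using compact_Int_closed[OF compact_dual_ball T(1)] by metis
qed

section \<open>Correcting by convex combinations of the approximate identity\<close>

text \<open>For \<open>\<phi>\<close> equal to \<open>t\<close> times a state \<open>\<psi>\<close>
  the limit is \<open>t * (\<delta> + Re (\<psi> x))\<close>.\<close>

lemma Q_e_limit_nonneg:
  assumes "\<phi> \<in> Q_e J e" and "\<And>\<psi>. \<psi> \<in> S_e J e \<Longrightarrow> - \<delta> \<le> Re (\<psi> x)"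
  obtains l where "(\<lambda>n. Re (\<phi> (\<delta> *\<^sub>R e n + x))) \<longlonglongrightarrow> l" "0 \<le> l"
proof -
  obtain t \<psi> where t: "0 \<le> t" "t \<le> 1" "\<psi> \<in> S_e J e" "\<phi> = (\<lambda>x. of_real t * \<psi> x)"
    using assms(1) by (rule Q_eE)
  have "(\<lambda>n. Re (of_real t * (of_real \<delta> * \<psi> (e n) + \<psi> x)))
      \<longlonglongrightarrow> Re (of_real t * (of_real \<delta> * 1 + \<psi> x))"
    using t by (intro tendsto_intros) (auto simp: S_e_def)
  then have "(\<lambda>n. Re (\<phi> (\<delta> *\<^sub>R e n + x))) \<longlonglongrightarrow> t * (\<delta> + Re (\<psi> x))"
    using t by (simp add: S_e_linear)
  moreover have "0 \<le> t * (\<delta> + Re (\<psi> x))"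
    using assms(2)[OF t(3)] t(1) by (intro mult_nonneg_nonneg) auto
  ultimately show ?thesis by (rule that)
qed

text \<open>Both elements are treated by one minimax argument on \<open>Q \<times> Q\<close>, with the sum of the two
  functionals; the single estimates come back because \<open>0 \<in> Q\<close>.\<close>

lemma exists_correction:
  fixes J :: "'a::{real_normed_algebra,banach} \<Rightarrow> 'a"
  assumes closed: "weak_star_closed J (Q_e J e)" and ne: "S_e J e \<noteq> {}" and "0 < \<epsilon>"
    and x: "\<And>\<psi>. \<psi> \<in> S_e J e \<Longrightarrow> - \<delta> \<le> Re (\<psi> x)"
    and y: "\<And>\<psi>. \<psi> \<in> S_e J e \<Longrightarrow> - \<delta> \<le> Re (\<psi> y)"
  obtains g where "g \<in> convex hull (e ` {N..})"
    "\<And>\<psi>. \<psi> \<in> S_e J e \<Longrightarrow> - \<epsilon> \<le> Re (\<psi> (\<delta> *\<^sub>R g + x))"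
    "\<And>\<psi>. \<psi> \<in> S_e J e \<Longrightarrow> - \<epsilon> \<le> Re (\<psi> (\<delta> *\<^sub>R g + y))"
proof -
  let ?Q = "Q_e J e"
  let ?G = "convex hull (e ` {N..})"
  define F where "F g p = Re (fst p (\<delta> *\<^sub>R g + x)) + Re (snd p (\<delta> *\<^sub>R g + y)) + \<epsilon>"
    for g and p :: "('a \<Rightarrow> complex) \<times> ('a \<Rightarrow> complex)"
  have zero: "(\<lambda>x. 0) \<in> ?Q" using ne by (rule zero_in_Q_e)
  have "\<exists>g\<in>?G. \<forall>p\<in>?Q \<times> ?Q. F g p > 0"
  proof (rule ccontr)
    assume no: "\<not> ?thesis"
    \<comment> \<open>The minimax theorem wants affinity in \<open>g\<close> at every
      \<open>p\<close>, but only members of \<open>Q_e J e\<close> are known to be linear; the value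
      0 elsewhere makes affinity trivial there.\<close>
    define F' where "F' g p = (if p \<in> ?Q \<times> ?Q then F g p else 0)" for g p
    have "\<exists>p\<in>?Q \<times> ?Q. \<forall>g\<in>?G. F' g p \<le> 0"
    proof (rule minimax)
      show "compact (?Q \<times> ?Q)"
        using compact_Q_e[OF closed] by (intro compact_Times)
      show "?Q \<times> ?Q \<noteq> {}" using zero by auto
      show "convexlike_on (?Q \<times> ?Q) ?G F'"
        unfolding convexlike_on_def
      proof (intro ballI)
        fix p q and s :: real
        assume p: "p \<in> ?Q \<times> ?Q" and q: "q \<in> ?Q \<times> ?Q" and s: "s \<in> {0..1}"
        define r where "r = ((\<lambda>x. of_real s * fst p x + of_real (1 - s) * fst q x),
          (\<lambda>x. of_real s * snd p x + of_real (1 - s) * snd q x))"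
        have r: "r \<in> ?Q \<times> ?Q"
          unfolding r_def using p q s by (auto simp del: of_real_diff intro!: Q_e_convex)
        have "F g r = s * F g p + (1 - s) * F g q" for g
          unfolding F_def r_def by (simp add: algebra_simps)
        then show "\<exists>r\<in>?Q \<times> ?Q. \<forall>g\<in>?G. F' g r = s * F' g p + (1 - s) * F' g q"
          using p q r by (auto simp: F'_def)
      qed
      fix g assume g: "g \<in> ?G"
      have "continuous_on (?Q \<times> ?Q) (F g)"
        unfolding F_def
        by (intro continuous_intros continuous_on_compose2[OF continuous_on_eval]) auto
      then show "continuous_on (?Q \<times> ?Q) (F' g)"
        by (rule continuous_on_eq) (auto simp: F'_def)
      show "\<exists>p\<in>?Q \<times> ?Q. F' g p \<le> 0"
        using no g by (force simp: F'_def not_less)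
    next
      fix g h p and s :: real assume "0 \<le> s" "s \<le> 1"
      show "F' (s *\<^sub>R g + (1 - s) *\<^sub>R h) p = s * F' g p + (1 - s) * F' h p"
      proof (cases "p \<in> ?Q \<times> ?Q")
        case True
        then have "fst p \<in> ?Q" "snd p \<in> ?Q" by auto
        moreover have "\<delta> *\<^sub>R (s *\<^sub>R g + (1 - s) *\<^sub>R h) + b
            = s *\<^sub>R (\<delta> *\<^sub>R g + b) + (1 - s) *\<^sub>R (\<delta> *\<^sub>R h + b)" for b
          by (simp add: algebra_simps)
        ultimately have "F (s *\<^sub>R g + (1 - s) *\<^sub>R h) p = s * F g p + (1 - s) * F h p"
          by (simp add: F_def Q_e_linear del: of_real_diff) (simp add: algebra_simps)
        then show ?thesis
          using True by (simp add: F'_def)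
      qed (simp add: F'_def)
    qed simp
    then obtain \<phi> \<psi> where p: "\<phi> \<in> ?Q" "\<psi> \<in> ?Q" "\<And>g. g \<in> ?G \<Longrightarrow> F g (\<phi>, \<psi>) \<le> 0"
      by (fastforce simp: F'_def)
    obtain l where l: "(\<lambda>n. Re (\<phi> (\<delta> *\<^sub>R e n + x))) \<longlonglongrightarrow> l" "0 \<le> l"
      using Q_e_limit_nonneg[OF p(1) x] .
    obtain m where m: "(\<lambda>n. Re (\<psi> (\<delta> *\<^sub>R e n + y))) \<longlonglongrightarrow> m" "0 \<le> m"
      using Q_e_limit_nonneg[OF p(2) y] .
    \<comment> \<open>The pair found does not depend on \<open>g\<close>, so it can be tested along
      the \<open>e n\<close> with \<open>n \<ge> N\<close>; the summand \<open>\<epsilon>\<close>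
      makes the limit strictly positive.\<close>
    have lim: "(\<lambda>n. F (e n) (\<phi>, \<psi>)) \<longlonglongrightarrow> l + m + \<epsilon>"
      unfolding F_def fst_conv snd_conv by (intro tendsto_intros l m)
    have "F (e n) (\<phi>, \<psi>) \<le> 0" if "n \<ge> N" for n
      using that by (intro p(3) hull_inc) auto
    with lim have "l + m + \<epsilon> \<le> 0"
      by (intro LIMSEQ_le_const2[OF lim]) auto
    with l m \<open>0 < \<epsilon>\<close> show False by linarith
  qed
  then obtain g where g: "g \<in> ?G" "\<And>p. p \<in> ?Q \<times> ?Q \<Longrightarrow> F g p > 0" by blast
  show ?thesis
  proof (rule that[OF g(1)])
    fix \<psi> assume "\<psi> \<in> S_e J e"
    then have \<psi>: "\<psi> \<in> ?Q" using S_e_subset_Q_e by blast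
    show "- \<epsilon> \<le> Re (\<psi> (\<delta> *\<^sub>R g + x))"
      using g(2)[of "(\<psi>, \<lambda>x. 0)"] \<psi> zero by (simp add: F_def)
    show "- \<epsilon> \<le> Re (\<psi> (\<delta> *\<^sub>R g + y))"
      using g(2)[of "(\<lambda>x. 0, \<psi>)"] \<psi> zero by (simp add: F_def)
  qed
qed

section \<open>Real positive elements in the closed hull of a tail\<close>

text \<open>The element is a series of terms \<open>\<delta> k *\<^sub>R g\<close> with
  \<open>g\<close> in the hull. After the steps before \<open>k\<close>, both estimates fail by at
  most \<open>\<delta> k\<close>, which is the weight of the next correction.\<close>

lemma exists_real_positive:
  fixes J :: "'a::{real_normed_algebra,banach} \<Rightarrow> 'a"
  assumes closed: "weak_star_closed J (Q_e J e)" and ne: "S_e J e \<noteq> {}"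
    and e: "\<And>n. norm (e n) \<le> 1"
    and c: "c > -1" "\<And>\<phi>. \<phi> \<in> S_e J e \<Longrightarrow> c \<le> Re (\<phi> a)"
  obtains f where "f \<in> closure (convex hull (e ` {N..}))" "f \<in> r_e J e" "f + a \<in> r_e J e"
proof -
  let ?S = "S_e J e"
  let ?G = "convex hull (e ` {N..})"
  \<comment> \<open>The first step spends \<open>1 - \<mu> = max 0 (- c)\<close>, just enough to
    offset the lower bound of \<open>a\<close>; \<open>c > -1\<close> leaves the positive weight
    \<open>\<mu>\<close> for the rest.\<close>
  define \<mu> where "\<mu> = 1 - max 0 (- c)"
  have \<mu>: "0 < \<mu>" "\<mu> \<le> 1" "- (1 - \<mu>) \<le> c" using c by (auto simp: \<mu>_def)
  \<comment> \<open>\<open>\<rho> k\<close> is the weight still available before step \<open>k\<close>, and \<open>\<delta> k\<close> the weight spent in it.\<close>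
  define \<rho> where "\<rho> k = (case k of 0 \<Rightarrow> 1 | Suc j \<Rightarrow> \<mu> / 2 ^ j)" for k
  define \<delta> where "\<delta> k = \<rho> k - \<rho> (Suc k)" for k
  have \<rho>_pos: "\<rho> k > 0" for k using \<mu> by (auto simp: \<rho>_def split: nat.split)
  have \<delta>_Suc: "\<delta> (Suc k) = \<mu> / 2 * (1 / 2) ^ k" for k
    by (simp add: \<delta>_def \<rho>_def field_simps)
  have \<delta>_nonneg: "\<delta> k \<ge> 0" for k
    using \<mu> by (cases k) (auto simp: \<delta>_Suc, simp add: \<delta>_def \<rho>_def)
  \<comment> \<open>Only from index 1 on: \<open>\<delta> 0\<close> vanishes when
    \<open>c \<ge> 0\<close>. This suffices, since the error allowed at step \<open>k\<close> is
    \<open>\<delta> (Suc k)\<close>.\<close>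
  have \<delta>_pos: "\<delta> (Suc k) > 0" for k
    using \<mu> by (simp add: \<delta>_Suc)
  have \<delta>_sum: "summable \<delta>"
    unfolding summable_Suc_iff[of \<delta>, symmetric] \<delta>_Suc
    by (intro summable_mult summable_geometric) auto
  have \<delta>_lim: "\<delta> \<longlonglongrightarrow> 0" using \<delta>_sum by (rule summable_LIMSEQ_zero)
  have \<rho>_lim: "\<rho> \<longlonglongrightarrow> 0"
  proof -
    have "(\<lambda>k. 2 * \<delta> (Suc k)) \<longlonglongrightarrow> 2 * 0"
      by (intro tendsto_intros LIMSEQ_Suc \<delta>_lim)
    moreover have "2 * \<delta> (Suc k) = \<rho> (Suc k)" for k
      by (simp add: \<delta>_Suc) (simp add: \<rho>_def power_divide)
    ultimately show ?thesis by (subst filterlim_sequentially_Suc[symmetric]) simp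
  qed
  have G_norm: "norm g \<le> 1" if "g \<in> ?G" for g
  proof -
    have "?G \<subseteq> cball 0 1" by (rule hull_minimal) (use e in auto)
    with that show ?thesis by auto
  qed
  \<comment> \<open>The last clause says that \<open>z\<close> is a convex combination with weight
    \<open>\<rho> k\<close> still missing, whichever point of the hull fills it.\<close>
  define P where "P k z \<longleftrightarrow> (\<forall>\<phi>\<in>?S. - \<delta> k \<le> Re (\<phi> (z + a)) \<and> - \<delta> k \<le> Re (\<phi> z)) \<and>
      (\<forall>g\<in>?G. z + \<rho> k *\<^sub>R g \<in> ?G)" for k z
  have "\<exists>z. \<forall>k. P k (z k) \<and> (\<exists>g\<in>?G. z (Suc k) = z k + \<delta> k *\<^sub>R g)"
  proof (rule dependent_nat_choice)
    have "- \<delta> 0 \<le> Re (\<phi> a) \<and> - \<delta> 0 \<le> Re (\<phi> 0)" if "\<phi> \<in> ?S" for \<phi>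
      using c(2)[OF that] \<mu> S_e_linear(2)[OF that, of 0 0] by (simp add: \<delta>_def \<rho>_def)
    then have "P 0 0" by (simp add: P_def) (simp add: \<rho>_def)
    then show "\<exists>z. P 0 z" ..
  next
    fix z k assume z: "P k z"
    obtain g where g: "g \<in> ?G"
      "\<And>\<phi>. \<phi> \<in> ?S \<Longrightarrow> - \<delta> (Suc k) \<le> Re (\<phi> (\<delta> k *\<^sub>R g + (z + a)))"
      "\<And>\<phi>. \<phi> \<in> ?S \<Longrightarrow> - \<delta> (Suc k) \<le> Re (\<phi> (\<delta> k *\<^sub>R g + z))"
      using exists_correction[OF closed ne \<delta>_pos[of k], of "\<delta> k" "z + a" z N] z
      unfolding P_def by blast
    have "z + \<delta> k *\<^sub>R g + \<rho> (Suc k) *\<^sub>R h \<in> ?G" if h: "h \<in> ?G" for h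
    proof -
      \<comment> \<open>Since \<open>\<delta> k + \<rho> (Suc k) = \<rho> k\<close>, the new term
        and the remaining weight together form \<open>\<rho> k\<close> times one point
        \<open>w\<close> of the hull.\<close>
      define w where "w = (\<delta> k / \<rho> k) *\<^sub>R g + (\<rho> (Suc k) / \<rho> k) *\<^sub>R h"
      have "w \<in> ?G"
        unfolding w_def using g(1) h \<delta>_nonneg[of k] \<rho>_pos[of k] \<rho>_pos[of "Suc k"]
        by (intro convexD[OF convex_convex_hull])
          (auto simp: add_divide_distrib[symmetric] \<delta>_def)
      moreover have "\<rho> k *\<^sub>R w = \<delta> k *\<^sub>R g + \<rho> (Suc k) *\<^sub>R h"
        unfolding w_def using \<rho>_pos[of k] by (simp add: scaleR_add_right)
      ultimately show ?thesis using z unfolding P_def by (metis add.assoc)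
    qed
    then have "P (Suc k) (z + \<delta> k *\<^sub>R g)"
      using g unfolding P_def by (auto simp: add_ac)
    then show "\<exists>z'. P (Suc k) z' \<and> (\<exists>g\<in>?G. z' = z + \<delta> k *\<^sub>R g)"
      using g(1) by blast
  qed
  then obtain z where z: "\<And>k. P k (z k)" "\<And>k. \<exists>g\<in>?G. z (Suc k) = z k + \<delta> k *\<^sub>R g"
    by blast
  have "norm (z (Suc k) - z k) \<le> \<delta> k" for k
  proof -
    obtain g where "g \<in> ?G" "z (Suc k) = z k + \<delta> k *\<^sub>R g" using z(2) by blast
    then show ?thesis
      using G_norm[of g] \<delta>_nonneg[of k] by (simp add: mult_left_le)
  qed
  then have "summable (\<lambda>k. z (Suc k) - z k)"
    by (intro summable_comparison_test[OF _ \<delta>_sum]) auto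
  then have "convergent z"
    by (simp add: summable_iff_convergent sum_lessThan_telescope convergent_diff_const_right_iff)
  then obtain f where f: "z \<longlonglongrightarrow> f" by (auto simp: convergent_def)
  have lim: "0 \<le> Re (\<phi> (f + b))"
    if \<phi>: "\<phi> \<in> ?S" and b: "\<And>k. - \<delta> k \<le> Re (\<phi> (z k + b))" for \<phi> b
  proof -
    have bl: "bounded_linear \<phi>" using \<phi> by (auto simp: S_e_def cdual_def)
    have "(\<lambda>k. Re (\<phi> (z k + b))) \<longlonglongrightarrow> Re (\<phi> (f + b))"
      by (intro tendsto_Re bounded_linear.tendsto[OF bl] tendsto_add f tendsto_const)
    moreover have "(\<lambda>k. - \<delta> k) \<longlonglongrightarrow> - 0" by (intro tendsto_intros \<delta>_lim)
    ultimately show ?thesis using b by (auto intro: LIMSEQ_le)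
  qed
  show ?thesis
  proof (rule that)
    show "f \<in> r_e J e" "f + a \<in> r_e J e"
      using lim[of _ 0] lim[of _ a] z(1) by (auto simp: r_e_def P_def)
    \<comment> \<open>The \<open>z k\<close> themselves need not lie in the hull; filling the
      missing weight with \<open>e N\<close> puts them there and does not change the limit.\<close>
    have "(\<lambda>k. z k + \<rho> k *\<^sub>R e N) \<longlonglongrightarrow> f + 0 *\<^sub>R e N"
      by (intro tendsto_intros f \<rho>_lim)
    moreover have "e N \<in> ?G" by (intro hull_inc) auto
    then have "z k + \<rho> k *\<^sub>R e N \<in> ?G" for k using z(1)[of k] unfolding P_def by blast
    ultimately show "f \<in> closure ?G"
      unfolding closure_sequential by (intro exI[of _ "\<lambda>k. z k + \<rho> k *\<^sub>R e N"]) simp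
  qed
qed

section \<open>From tail hulls to approximate identities\<close>

text \<open>Each requirement on a tail confines it to a closed convex set, namely the unit ball or
  the preimage of a ball under multiplication by a fixed element. Such a set also contains the
  closed convex hull of the tail.\<close>

lemma seq_cai_closed_convex_hull_tails:
  assumes e: "seq_cai e" and f: "\<And>n. f n \<in> closure (convex hull (e ` {n..}))"
  shows "seq_cai f"
proof -
  have tail: "f n \<in> C" if "closed C" "convex C" "\<And>k. k \<ge> n \<Longrightarrow> e k \<in> C" for n C
  proof -
    have "closure (convex hull (e ` {n..})) \<subseteq> C"
      by (intro closure_minimal hull_minimal) (use that in auto)
    then show ?thesis using f by blast
  qed
  have lim: "(\<lambda>n. T (f n)) \<longlonglongrightarrow> a" if T: "bounded_linear T" and Te: "(\<lambda>n. T (e n)) \<longlonglongrightarrow> a"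
    for T and a :: 'a
  proof (rule metric_LIMSEQ_I)
    fix r :: real assume r: "0 < r"
    obtain N where N: "\<And>n. n \<ge> N \<Longrightarrow> dist (T (e n)) a < r / 2"
      using metric_LIMSEQ_D[OF Te, of "r / 2"] r by auto
    have "T (f n) \<in> cball a (r / 2)" if "n \<ge> N" for n
    proof -
      have "f n \<in> T -` cball a (r / 2)"
      proof (rule tail)
        show "closed (T -` cball a (r / 2))"
          by (intro closed_vimage bounded_linear.continuous_on[OF T] continuous_intros) auto
        show "convex (T -` cball a (r / 2))"
          by (intro convex_linear_vimage bounded_linear.linear[OF T] convex_cball)
      qed (use N that in \<open>auto simp: dist_commute less_imp_le\<close>)
      then show ?thesis by simp
    qed
    then show "\<exists>N. \<forall>n\<ge>N. dist (T (f n)) a < r"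
      using r by (intro exI[of _ N]) (fastforce simp: dist_commute)
  qed
  have "norm (f n) \<le> 1" for n
    using tail[of "cball 0 1" n] e by (auto simp: seq_cai_def)
  then show ?thesis
    using e lim[OF bounded_linear_mult_left] lim[OF bounded_linear_mult_right]
    by (auto simp: seq_cai_def)
qed

lemma exists_real_positive_cai:
  fixes J :: "'a::{real_normed_algebra,banach} \<Rightarrow> 'a"
  assumes e: "seq_cai e" and closed: "weak_star_closed J (Q_e J e)"
    and c: "c > -1" "\<And>\<phi>. \<phi> \<in> S_e J e \<Longrightarrow> c \<le> Re (\<phi> a)"
  shows "\<exists>f. seq_cai f \<and> (\<forall>n. f n \<in> r_e J e \<and> f n + a \<in> r_e J e)"
\<comment> \<open>Without states \<open>r_e J e\<close> is the whole algebra and \<open>e\<close>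
  itself serves; otherwise one element is chosen for each tail.\<close>
proof (cases "S_e J e = {}")
  case True
  then show ?thesis using e by (auto simp: r_e_def)
next
  case False
  have "\<exists>f. f \<in> closure (convex hull (e ` {n..})) \<and> f \<in> r_e J e \<and> f + a \<in> r_e J e" for n
  proof -
    have "norm (e k) \<le> 1" for k using e by (simp add: seq_cai_def)
    then obtain f where "f \<in> closure (convex hull (e ` {n..}))" "f \<in> r_e J e" "f + a \<in> r_e J e"
      using exists_real_positive[where N = n and a = a and c = c and e = e and J = J]
        closed False c by blast
    then show ?thesis by blast
  qed
  then obtain f where "\<And>n. f n \<in> closure (convex hull (e ` {n..}))"
    "\<And>n. f n \<in> r_e J e" "\<And>n. f n + a \<in> r_e J e" by metis
  then show ?thesis using seq_cai_closed_convex_hull_tails[OF e] by blast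
qed

theorem theorem2p9:
  fixes J :: "'a::{real_normed_algebra,banach} \<Rightarrow> 'a" and e :: "nat \<Rightarrow> 'a"
  assumes "complex_structure J"
    and "seq_cai e"
    and "weak_star_closed J (Q_e J e)"
  shows "(\<exists>f. seq_cai f \<and> (\<forall>n. f n \<in> r_e J e)) \<and>
         (\<forall>a. (\<exists>c > -1. \<forall>\<phi> \<in> S_e J e. c \<le> Re (\<phi> a)) \<longrightarrow>
              (\<exists>f. seq_cai f \<and> (\<forall>n. f n \<in> r_e J e \<and> f n + a \<in> r_e J e)))"
proof (intro conjI allI impI)
  have "0 \<le> Re (\<phi> 0)" if "\<phi> \<in> S_e J e" for \<phi>
    using S_e_linear(2)[OF that, of 0 0] by simp
  then show "\<exists>f. seq_cai f \<and> (\<forall>n. f n \<in> r_e J e)"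
    using exists_real_positive_cai[where c = 0 and a = 0, OF assms(2,3)] by auto
next
  fix a assume "\<exists>c > -1. \<forall>\<phi> \<in> S_e J e. c \<le> Re (\<phi> a)"
  then obtain c where "c > -1" "\<And>\<phi>. \<phi> \<in> S_e J e \<Longrightarrow> c \<le> Re (\<phi> a)" by blast
  then show "\<exists>f. seq_cai f \<and> (\<forall>n. f n \<in> r_e J e \<and> f n + a \<in> r_e J e)"
    by (rule exists_real_positive_cai[where c = c and a = a, OF assms(2,3)])
qed

end
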